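(* There is a finitely generated free group $G$, a subgroup of infinite index $H\leq G$, and a measure preserving action of $G$ on a standard probability space $(X,\mu)$ such that both $f_G(X,\mu)$ and $f_H(X,\mu)$ are defined (with $H$ acting by restriction) but $f_H(X,\mu)\neq|G:H|\cdot f_G(X,\mu)$.
   Context: Convention: when $|G:H|=\infty$, the equation $f_H(X,\mu)=|G:H|\cdot f_G(X,\mu)$ is taken to mean that $f_G(X,\mu)=0$ if $f_H(X,\mu)$ is finite, $f_H(X,\mu)=-\infty$ if $f_G(X,\mu)<0$, and $f_H(X,\mu)$ is undefined if $f_G(X,\mu)>0$; the notation $f_H(X,\mu)\neq|G:H|\cdot f_G(X,\mu)$ means that this fails. For a countable measurable partition $\alpha$ of $X$, $g\in G$ and finite $F\subseteq G$, put $g\cdot\alpha=\{g\cdot A : A\in\alpha\}$ and $F\cdot\alpha=\bigvee_{f\in F} f\cdot\alpha$. The Shannon entropy is $\mathrm{H}(\alpha)=\sum_{A\in\alpha}-\mu(A)\log\mu(A)$. A countable measurable partition $\alpha$ is generating for an action of a group if the smallest invariant $\sigma$-algebra containing $\alpha$ contains all measurable sets up to null sets. f-invariant entropy (for actions of finitely generated free groups): let $G$ be a finitely generated free group with free generating set $S$, $r=|S|$, acting measure preservingly on $(X,\mu)$. For $\mathrm{H}(\alpha)<\infty$ set $F_G(X,\mu,S,\alpha)=(1-2r)\mathrm{H}(\alpha)+\sum_{s\in S}\mathrm{H}(s\cdot\alpha\vee\alpha)$, and let $B_S(n)$ be the $S$-ball of radius $n$ about $1_G$. If there is a generating partition $\alpha$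 with $\mathrm{H}(\alpha)<\infty$, define $f_G(X,\mu)=\lim_{n\to\infty}F_G(X,\mu,S,B_S(n)\cdot\alpha)\in[-\infty,\infty)$, which by theorems of Bowen exists and is independent of $S$ and $\alpha$; otherwise $f_G(X,\mu)$ is undefined. *)

theory Defs
  imports
    "HOL-Probability.Probability"
    "HOL-Algebra.Generated_Groups"
    "HOL-Algebra.Group_Action"
begin

subsection \<open>Free generating sets\<close>

text \<open>
  A word over \<open>S\<close> is a list of pairs \<open>(s, b)\<close> with \<open>s \<in> S\<close>; the letter \<open>(s, True)\<close> stands for
  \<open>s\<close> and \<open>(s, False)\<close> for its inverse.
\<close>

definition letter_val :: "('g, 'z) monoid_scheme \<Rightarrow> 'g \<times> bool \<Rightarrow> 'g" where
  "letter_val G l = (if snd l then fst l else inv\<^bsub>G\<^esub> (fst l))"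

definition word_val :: "('g, 'z) monoid_scheme \<Rightarrow> ('g \<times> bool) list \<Rightarrow> 'g" where
  "word_val G w = foldr (\<lambda>l x. letter_val G l \<otimes>\<^bsub>G\<^esub> x) w \<one>\<^bsub>G\<^esub>"

definition words_over :: "'g set \<Rightarrow> ('g \<times> bool) list set" where
  "words_over S = lists (S \<times> UNIV)"

definition reduced_word :: "('g \<times> bool) list \<Rightarrow> bool" where
  "reduced_word w \<longleftrightarrow> successively (\<lambda>l m. \<not> (fst l = fst m \<and> snd l \<noteq> snd m)) w"

definition free_generating_set :: "('g, 'z) monoid_scheme \<Rightarrow> 'g set \<Rightarrow> bool" where
  "free_generating_set G S \<longleftrightarrow>
     S \<subseteq> carrier G \<and> generate G S = carrier G \<and>
     (\<forall>w \<in> words_over S. reduced_word w \<and> w \<noteq> [] \<longrightarrow> word_val G w \<noteq> \<one>\<^bsub>G\<^esub>)"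

definition fg_free_group :: "('g, 'z) monoid_scheme \<Rightarrow> bool" where
  "fg_free_group G \<longleftrightarrow> group G \<and> (\<exists>S. finite S \<and> free_generating_set G S)"

definition word_ball :: "('g, 'z) monoid_scheme \<Rightarrow> 'g set \<Rightarrow> nat \<Rightarrow> 'g set" where
  "word_ball G S n = {word_val G w |w. w \<in> words_over S \<and> length w \<le> n}"

subsection \<open>Measure preserving actions on standard probability spaces\<close>

definition standard_probability_space :: "'x measure \<Rightarrow> bool" where
  "standard_probability_space M \<longleftrightarrow>
     prob_space M \<and>
     (\<exists>T. completely_metrizable_space T \<and> second_countable T \<and> topspace T = space M \<and>
          sets M = sigma_sets (topspace T) {U. openin T U})"

definition pmp_action ::
    "('g, 'z) monoid_scheme \<Rightarrow> 'x measure \<Rightarrow> ('g \<Rightarrow> 'x \<Rightarrow> 'x) \<Rightarrow> bool" where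
  "pmp_action G M \<phi> \<longleftrightarrow>
     group_action G (space M) \<phi> \<and>
     (\<forall>g \<in> carrier G. \<phi> g \<in> measurable M M \<and> distr M M (\<phi> g) = M)"

subsection \<open>Partitions and Shannon entropy\<close>

text \<open>As \<^const>\<open>partition_on\<close> requires, the empty set is never a class of a partition.\<close>

definition countable_measurable_partition :: "'x measure \<Rightarrow> 'x set set \<Rightarrow> bool" where
  "countable_measurable_partition M \<alpha> \<longleftrightarrow>
     countable \<alpha> \<and> \<alpha> \<subseteq> sets M \<and> partition_on (space M) \<alpha>"

definition translate :: "('g \<Rightarrow> 'x \<Rightarrow> 'x) \<Rightarrow> 'g \<Rightarrow> 'x set set \<Rightarrow> 'x set set" where
  "translate \<phi> g \<alpha> = (\<lambda>A. \<phi> g ` A) ` \<alpha>"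

definition translate_join :: "('g \<Rightarrow> 'x \<Rightarrow> 'x) \<Rightarrow> 'g set \<Rightarrow> 'x set set \<Rightarrow> 'x set set" where
  "translate_join \<phi> F \<alpha> = common_refinement ((\<lambda>f. translate \<phi> f \<alpha>) ` F)"

definition shannon_entropy :: "'x measure \<Rightarrow> 'x set set \<Rightarrow> ennreal" where
  "shannon_entropy M \<alpha> = (\<Sum>\<^sub>\<infinity>A\<in>\<alpha>. ennreal (- (measure M A * ln (measure M A))))"

definition invariant_sigma_algebra ::
    "('g, 'z) monoid_scheme \<Rightarrow> 'x set \<Rightarrow> ('g \<Rightarrow> 'x \<Rightarrow> 'x) \<Rightarrow> 'x set set \<Rightarrow> bool" where
  "invariant_sigma_algebra G X \<phi> \<Sigma> \<longleftrightarrow>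
     sigma_algebra X \<Sigma> \<and> (\<forall>g \<in> carrier G. \<forall>A \<in> \<Sigma>. \<phi> g ` A \<in> \<Sigma>)"

definition generating_partition ::
    "('g, 'z) monoid_scheme \<Rightarrow> 'x measure \<Rightarrow> ('g \<Rightarrow> 'x \<Rightarrow> 'x) \<Rightarrow> 'x set set \<Rightarrow> bool" where
  "generating_partition G M \<phi> \<alpha> \<longleftrightarrow>
     countable_measurable_partition M \<alpha> \<and>
     (\<forall>B \<in> sets M. \<exists>C \<in> \<Inter> {\<Sigma>. invariant_sigma_algebra G (space M) \<phi> \<Sigma> \<and> \<alpha> \<subseteq> \<Sigma>}.
        (B - C) \<union> (C - B) \<in> null_sets M)"

subsection \<open>The f-invariant\<close>

text \<open>Only meaningful for \<open>\<alpha>\<close> of finite entropy: all joins below then have finite entropy too.\<close>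

definition F_entropy ::
    "'x measure \<Rightarrow> ('g \<Rightarrow> 'x \<Rightarrow> 'x) \<Rightarrow> 'g set \<Rightarrow> 'x set set \<Rightarrow> real" where
  "F_entropy M \<phi> S \<alpha> =
     (1 - 2 * real (card S)) * enn2real (shannon_entropy M \<alpha>) +
     (\<Sum>s\<in>S. enn2real (shannon_entropy M (common_refinement {translate \<phi> s \<alpha>, \<alpha>})))"

definition f_invariant_is ::
    "('g, 'z) monoid_scheme \<Rightarrow> 'x measure \<Rightarrow> ('g \<Rightarrow> 'x \<Rightarrow> 'x) \<Rightarrow> ereal \<Rightarrow> bool" where
  "f_invariant_is G M \<phi> v \<longleftrightarrow>
     (\<forall>S \<alpha>. finite S \<and> free_generating_set G S \<and>
            generating_partition G M \<phi> \<alpha> \<and> shannon_entropy M \<alpha> < \<infinity> \<longrightarrow>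
        (\<lambda>n. ereal (F_entropy M \<phi> S (translate_join \<phi> (word_ball G S n) \<alpha>))) \<longlonglongrightarrow> v)"

text \<open>
  \<^const>\<open>None\<close> encodes ``undefined''. By theorems of Bowen the limit exists and does not depend on
  \<open>S\<close> and \<open>\<alpha>\<close>, so the definite description is proper for every measure preserving action.
\<close>

definition f_invariant ::
    "('g, 'z) monoid_scheme \<Rightarrow> 'x measure \<Rightarrow> ('g \<Rightarrow> 'x \<Rightarrow> 'x) \<Rightarrow> ereal option" where
  "f_invariant G M \<phi> =
     (if fg_free_group G \<and> (\<exists>\<alpha>. generating_partition G M \<phi> \<alpha> \<and> shannon_entropy M \<alpha> < \<infinity>)
      then Some (THE v. f_invariant_is G M \<phi> v) else None)"

text \<open>
  The meaning of the equation \<open>f\<^sub>H = |G:H| \<cdot> f\<^sub>G\<close> for a subgroup \<open>H\<close> of infinite index, with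
  arguments \<open>f\<^sub>H\<close> and \<open>f\<^sub>G\<close> in this order.
\<close>

definition infinite_index_formula :: "ereal option \<Rightarrow> ereal option \<Rightarrow> bool" where
  "infinite_index_formula fH fG \<longleftrightarrow>
     ((\<exists>a. fH = Some a \<and> \<bar>a\<bar> \<noteq> \<infinity>) \<longrightarrow> fG = Some 0) \<and>
     ((\<exists>b. fG = Some b \<and> b < 0) \<longrightarrow> fH = Some (-\<infinity>)) \<and>
     ((\<exists>b. fG = Some b \<and> b > 0) \<longrightarrow> fH = None)"

end

theory Submission
  imports Defs
begin

text \<open>
  Let the free group of rank 2 act trivially on two points of mass 1/2. Since a translate of a
  partition is that partition, \<open>F\<^sub>G(\<alpha>) = (1 - 2r + r) H(\<alpha>)\<close> for a group freely generated by \<open>r\<close>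
  elements, and the only generating partition is the one into points; so the f-invariant is
  \<open>(1 - r) log 2\<close>. It is negative for rank 2 and equals \<open>log 2\<close>, hence is not \<open>-\<infinity>\<close>, for the trivial
  subgroup, which is free of rank 0. The rank of a finitely generated free group \<open>G\<close> is
  well defined because \<open>G\<close> has exactly \<open>2\<^sup>r\<close> homomorphisms to \<open>\<int>/2\<close>.
\<close>

subsection \<open>Free generating sets\<close>

lemma words_over_simps [simp]:
  "[] \<in> words_over S"
  "l # w \<in> words_over S \<longleftrightarrow> fst l \<in> S \<and> w \<in> words_over S"
  "u @ v \<in> words_over S \<longleftrightarrow> u \<in> words_over S \<and> v \<in> words_over S"
  by (auto simp: words_over_def mem_Times_iff)

lemma words_over_mono: "\<lbrakk>w \<in> words_over S; S \<subseteq> T\<rbrakk> \<Longrightarrow> w \<in> words_over T"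
  by (auto simp: words_over_def)

lemma word_val_simps [simp]:
  "word_val G [] = \<one>\<^bsub>G\<^esub>"
  "word_val G (l # w) = letter_val G l \<otimes>\<^bsub>G\<^esub> word_val G w"
  by (simp_all add: word_val_def)

lemma not_reduced_wordE:
  assumes "\<not> reduced_word w"
  obtains u x y v where "w = u @ x # y # v" "fst x = fst y" "snd x \<noteq> snd y"
proof -
  have "\<exists>u x y v. w = u @ x # y # v \<and> fst x = fst y \<and> snd x \<noteq> snd y"
    using assms
  proof (induction w)
    case Nil
    then show ?case by (simp add: reduced_word_def)
  next
    case (Cons a w)
    show ?case
    proof (cases "reduced_word w")
      case True
      with Cons.prems obtain b v where "w = b # v" "fst a = fst b" "snd a \<noteq> snd b"
        by (cases w) (auto simp: reduced_word_def)
      then have "a # w = [] @ a # b # v \<and> fst a = fst b \<and> snd a \<noteq> snd b" by simp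
      then show ?thesis by blast
    next
      case False
      with Cons.IH obtain u x y v where "w = u @ x # y # v \<and> fst x = fst y \<and> snd x \<noteq> snd y"
        by blast
      then have "a # w = (a # u) @ x # y # v \<and> fst x = fst y \<and> snd x \<noteq> snd y" by simp
      then show ?thesis by blast
    qed
  qed
  with that show ?thesis by blast
qed

definition inverse_word :: "('g \<times> bool) list \<Rightarrow> ('g \<times> bool) list" where
  "inverse_word w = rev (map (\<lambda>(s, b). (s, \<not> b)) w)"

lemma inverse_word_simps [simp]:
  "inverse_word [] = []"
  "inverse_word (l # w) = inverse_word w @ [(fst l, \<not> snd l)]"
  by (simp_all add: inverse_word_def split_beta)

lemma inverse_word_words_over [simp]: "inverse_word w \<in> words_over S \<longleftrightarrow> w \<in> words_over S"
  by (induction w) auto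

context group
begin

lemma letter_val_closed [simp]: "fst l \<in> carrier G \<Longrightarrow> letter_val G l \<in> carrier G"
  by (simp add: letter_val_def)

lemma word_val_closed [simp]: "w \<in> words_over (carrier G) \<Longrightarrow> word_val G w \<in> carrier G"
  by (induction w) auto

lemma word_val_append:
  "\<lbrakk>u \<in> words_over (carrier G); v \<in> words_over (carrier G)\<rbrakk>
    \<Longrightarrow> word_val G (u @ v) = word_val G u \<otimes> word_val G v"
  by (induction u) (auto simp: m_assoc)

lemma word_val_inverse_word:
  "w \<in> words_over (carrier G) \<Longrightarrow> word_val G (inverse_word w) = inv (word_val G w)"
  by (induction w) (auto simp: word_val_append inv_mult_group letter_val_def)

text \<open>\<open>generate\<close> inverts only members of \<open>S\<close> itself, so its rules
  correspond to the empty word, the one-letter words and concatenation.\<close>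

lemma generate_eq_word_val:
  assumes S: "S \<subseteq> carrier G"
  shows "generate G S = word_val G ` words_over S"
proof (intro equalityI subsetI)
  fix g assume "g \<in> generate G S"
  then show "g \<in> word_val G ` words_over S"
  proof (induction rule: generate.induct)
    case one
    show ?case by (rule image_eqI[where x = "[]"]) auto
  next
    case (incl h)
    with S show ?case by (intro image_eqI[where x = "[(h, True)]"]) (auto simp: letter_val_def)
  next
    case (inv h)
    with S show ?case by (intro image_eqI[where x = "[(h, False)]"]) (auto simp: letter_val_def)
  next
    case (eng h1 h2)
    then obtain u v where "u \<in> words_over S" "h1 = word_val G u"
      "v \<in> words_over S" "h2 = word_val G v" by auto
    with S show ?case
      by (intro image_eqI[where x = "u @ v"]) (auto simp: word_val_append words_over_mono)
  qed
next
  fix g assume "g \<in> word_val G ` words_over S"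
  then obtain w where "w \<in> words_over S" "g = word_val G w" by auto
  moreover have "w \<in> words_over S \<Longrightarrow> word_val G w \<in> generate G S"
    by (induction w) (auto intro: generate.intros simp: letter_val_def)
  ultimately show "g \<in> generate G S" by simp
qed

section \<open>Homomorphisms to Z/2, as predicates with exclusive or for addition, and invariance of
  the rank\<close>

abbreviation odd_hom :: "('a \<Rightarrow> bool) \<Rightarrow> bool" where
  "odd_hom \<eta> \<equiv> \<forall>g\<in>carrier G. \<forall>h\<in>carrier G. \<eta> (g \<otimes> h) \<longleftrightarrow> \<eta> g \<noteq> \<eta> h"

text \<open>Every element of Z/2 is its own negative.\<close>

lemma odd_hom_inv:
  assumes "odd_hom \<eta>" "g \<in> carrier G"
  shows "\<eta> (inv g) \<longleftrightarrow> \<eta> g"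
proof -
  have "\<not> \<eta> \<one>"
    using assms(1) one_closed l_one[OF one_closed] by metis
  with assms show ?thesis
    using r_inv[of g] inv_closed[of g] by metis
qed

lemma odd_hom_eqI:
  assumes "odd_hom \<eta>" "odd_hom \<psi>" "S \<subseteq> carrier G" "generate G S = carrier G"
    and "\<And>s. s \<in> S \<Longrightarrow> \<eta> s \<longleftrightarrow> \<psi> s" and g: "g \<in> carrier G"
  shows "\<eta> g \<longleftrightarrow> \<psi> g"
proof -
  have one: "\<not> \<eta> \<one>" "\<not> \<psi> \<one>"
    using assms(1,2) one_closed l_one[OF one_closed] by metis+
  have "g \<in> generate G S" using g assms(4) by simp
  then show ?thesis
  proof (induction rule: generate.induct)
    case (inv h)
    then show ?case using assms(3,5) odd_hom_inv[OF assms(1)] odd_hom_inv[OF assms(2)] by blast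
  next
    case (eng h1 h2)
    then have "h1 \<in> carrier G" "h2 \<in> carrier G" using assms(4) by auto
    with eng assms(1,2) show ?case by simp
  qed (use assms(5) one in auto)
qed

text \<open>By freeness, a nonempty word with value \<open>\<one>\<close> is not reduced, so it
  contains a cancelling pair. Both letters of the pair carry the same generator, so deleting them
  lowers the count by 0 or 2 and keeps the value; induct on the length.\<close>

lemma even_letters_of_trivial_word:
  assumes "free_generating_set G S" "w \<in> words_over S" "word_val G w = \<one>"
  shows "even (length (filter (\<lambda>l. fst l \<in> A) w))"
  using assms(2,3)
proof (induction "length w" arbitrary: w rule: less_induct)
  case less
  have S: "S \<subseteq> carrier G" using assms(1) by (simp add: free_generating_set_def)
  show ?case
  proof (cases "reduced_word w")
    case True
    with less.prems assms(1) have "w = []" by (auto simp: free_generating_set_def)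
    then show ?thesis by simp
  next
    case False
    then obtain u x y v where w: "w = u @ x # y # v" and xy: "fst x = fst y" "snd x \<noteq> snd y"
      by (rule not_reduced_wordE)
    have in_carrier: "u \<in> words_over (carrier G)" "v \<in> words_over (carrier G)"
      "fst y \<in> carrier G" using less.prems(1) S w by (auto intro: words_over_mono)
    have "letter_val G x \<otimes> (letter_val G y \<otimes> z) = z" if "z \<in> carrier G" for z
      using xy in_carrier that by (cases "snd x") (auto simp: letter_val_def m_assoc[symmetric])
    then have "word_val G (u @ v) = word_val G w"
      using in_carrier w xy by (simp add: word_val_append)
    then have "even (length (filter (\<lambda>l. fst l \<in> A) (u @ v)))"
      using less.prems w by (intro less.hyps) auto
    then show ?thesis using w xy by simp
  qed
qed

text \<open>The universal property of a free group, for target Z/2: the homomorphism counts the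
  letters from \<open>A\<close> modulo 2 in any word for the element.\<close>

lemma ex_odd_hom:
  assumes "free_generating_set G S"
  shows "\<exists>\<eta>. odd_hom \<eta> \<and> (\<forall>s\<in>S. \<eta> s \<longleftrightarrow> s \<in> A)"
proof -
  have S: "S \<subseteq> carrier G" and gen: "carrier G = word_val G ` words_over S"
    using assms generate_eq_word_val by (auto simp: free_generating_set_def)
  have carr: "w \<in> words_over S \<Longrightarrow> w \<in> words_over (carrier G)" for w
    using S words_over_mono by blast
  define N where "N = (\<lambda>w :: ('a \<times> bool) list. length (filter (\<lambda>l. fst l \<in> A) w))"
  have N_append: "N (u @ v) = N u + N v" for u v by (simp add: N_def)
  have N_inverse: "N (inverse_word w) = N w" for w
    by (induction w) (auto simp: N_def)
  \<comment> \<open>Independence of the chosen word: if \<open>u\<close> and \<open>v\<close> have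
    equal values, then \<open>u @ inverse_word v\<close> is a trivial word, and inverting a word
    keeps its count.\<close>
  have wd: "even (N u) \<longleftrightarrow> even (N v)"
    if "u \<in> words_over S" "v \<in> words_over S" "word_val G u = word_val G v" for u v
  proof -
    have "word_val G (u @ inverse_word v) = \<one>"
      using that by (simp add: carr word_val_append word_val_inverse_word)
    then have "even (N (u @ inverse_word v))"
      unfolding N_def using that by (intro even_letters_of_trivial_word[OF assms]) auto
    then show ?thesis by (simp add: N_append N_inverse)
  qed
  define W where "W = (\<lambda>g. SOME w. w \<in> words_over S \<and> word_val G w = g)"
  have W: "W g \<in> words_over S" "word_val G (W g) = g" if "g \<in> carrier G" for g
  proof -
    have "\<exists>w. w \<in> words_over S \<and> word_val G w = g" using that gen by auto
    then have "W g \<in> words_over S \<and> word_val G (W g) = g" unfolding W_def by (rule someI_ex)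
    then show "W g \<in> words_over S" "word_val G (W g) = g" by auto
  qed
  define \<eta> where "\<eta> = (\<lambda>g. odd (N (W g)))"
  have "\<eta> (g \<otimes> h) \<longleftrightarrow> \<eta> g \<noteq> \<eta> h" if "g \<in> carrier G" "h \<in> carrier G" for g h
    using wd[of "W (g \<otimes> h)" "W g @ W h"] W that
    by (auto simp: \<eta>_def N_append word_val_append carr)
  moreover have "\<eta> s \<longleftrightarrow> s \<in> A" if "s \<in> S" for s
  proof -
    have "word_val G [(s, True)] = s" using that S by (auto simp: letter_val_def)
    then have "even (N (W s)) \<longleftrightarrow> even (N [(s, True)])"
      using that S W by (intro wd) auto
    then show ?thesis by (simp add: \<eta>_def N_def)
  qed
  ultimately show ?thesis by (intro exI[of _ \<eta>]) simp
qed

text \<open>Each subset of \<open>S\<close> extends to a homomorphism to Z/2, which is determined by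
  its values on \<open>T\<close>. This embeds \<open>Pow S\<close> into \<open>Pow T\<close>, and
  finiteness of \<open>S\<close> comes out as well.\<close>

lemma free_generating_set_card_le:
  assumes S: "free_generating_set G S" and T: "free_generating_set G T" "finite T"
  shows "card S \<le> card T \<and> finite S"
proof -
  have "\<forall>A. \<exists>\<eta>. odd_hom \<eta> \<and> (\<forall>s\<in>S. \<eta> s \<longleftrightarrow> s \<in> A)"
    by (intro allI ex_odd_hom[OF S])
  from choice[OF this] obtain \<eta> where
    "\<forall>A. odd_hom (\<eta> A) \<and> (\<forall>s\<in>S. \<eta> A s \<longleftrightarrow> s \<in> A)" ..
  then have hom: "\<And>A. odd_hom (\<eta> A)" and \<eta>: "\<And>A s. s \<in> S \<Longrightarrow> \<eta> A s \<longleftrightarrow> s \<in> A"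
    by simp_all
  \<comment> \<open>The subset of \<open>T\<close> on which the homomorphism attached to
    \<open>A\<close> is nonzero.\<close>
  define r where "r = (\<lambda>A. {t\<in>T. \<eta> A t})"
  have inj: "inj_on r (Pow S)"
  proof (rule inj_onI)
    fix A B assume A: "A \<in> Pow S" and B: "B \<in> Pow S" and eq: "r A = r B"
    have "\<eta> A t \<longleftrightarrow> \<eta> B t" if "t \<in> T" for t
      using eq that by (auto simp: r_def)
    then have "\<eta> A g \<longleftrightarrow> \<eta> B g" if "g \<in> carrier G" for g
      using odd_hom_eqI[of "\<eta> A" "\<eta> B" T g] hom T(1) that
      unfolding free_generating_set_def by blast
    then have "s \<in> A \<longleftrightarrow> s \<in> B" if "s \<in> S" for s
      using \<eta> that S by (auto simp: free_generating_set_def)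
    with A B show "A = B" by auto
  qed
  have sub: "r ` Pow S \<subseteq> Pow T" by (auto simp: r_def)
  have fin: "finite S" using finite_subset[OF sub] T(2) finite_image_iff[OF inj] by simp
  have "(2::nat) ^ card S \<le> 2 ^ card T"
    using card_inj_on_le[OF inj sub] T(2) fin by (simp add: card_Pow)
  with fin show ?thesis by simp
qed

lemma free_generating_set_card_eq:
  assumes "free_generating_set G S" "finite S" "free_generating_set G T" "finite T"
  shows "card S = card T"
  using assms free_generating_set_card_le by (meson le_antisym)

end

text \<open>Rank 0: the empty word is the only word over \<open>{}\<close>, so the freeness
  condition holds vacuously.\<close>

lemma (in group) free_generating_set_trivial: "free_generating_set (G\<lparr>carrier := {\<one>}\<rparr>) {}"
proof -
  have "generate (G\<lparr>carrier := {\<one>}\<rparr>) {} = {\<one>}"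
  proof (intro equalityI subsetI)
    fix g assume "g \<in> generate (G\<lparr>carrier := {\<one>}\<rparr>) {}"
    then show "g \<in> {\<one>}" by (induction rule: generate.induct) auto
  next
    fix g assume "g \<in> {\<one>}"
    then show "g \<in> generate (G\<lparr>carrier := {\<one>}\<rparr>) {}"
      using generate.one[of "G\<lparr>carrier := {\<one>}\<rparr>" "{}"] by simp
  qed
  then show ?thesis by (auto simp: free_generating_set_def words_over_def)
qed

subsection \<open>The free group of rank 2 on the natural numbers\<close>

fun reduced_cons :: "'a \<times> bool \<Rightarrow> ('a \<times> bool) list \<Rightarrow> ('a \<times> bool) list" where
  "reduced_cons l [] = [l]"
| "reduced_cons l (m # w) = (if fst l = fst m \<and> snd l \<noteq> snd m then w else l # m # w)"

text \<open>The letters of \<open>u\<close> act on \<open>v\<close> one after another, starting with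
  the last. In particular \<open>reduced_append u []\<close> is the reduced form of an arbitrary
  word \<open>u\<close>.\<close>

definition reduced_append ::
    "('a \<times> bool) list \<Rightarrow> ('a \<times> bool) list \<Rightarrow> ('a \<times> bool) list" where
  "reduced_append u v = foldr reduced_cons u v"

lemma reduced_append_simps [simp]:
  "reduced_append [] v = v"
  "reduced_append (l # u) v = reduced_cons l (reduced_append u v)"
  by (simp_all add: reduced_append_def)

lemma reduced_word_reduced_cons: "reduced_word w \<Longrightarrow> reduced_word (reduced_cons l w)"
  by (cases w) (auto simp: reduced_word_def successively_Cons)

lemma reduced_word_reduced_append: "reduced_word v \<Longrightarrow> reduced_word (reduced_append u v)"
  by (induction u) (auto simp: reduced_word_reduced_cons)

text \<open>A letter and its inverse act as mutually inverse maps on reduced words. If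
  \<open>w\<close> starts with \<open>l\<close>, then \<open>m\<close> removes it and
  \<open>l\<close> is put back; reducedness of \<open>w\<close> excludes a further cancellation
  there.\<close>

lemma reduced_cons_cancel:
  assumes "reduced_word w" "fst l = fst m" "snd l \<noteq> snd m"
  shows "reduced_cons l (reduced_cons m w) = w"
proof (cases w)
  case Nil
  with assms show ?thesis by simp
next
  case (Cons n v)
  then show ?thesis
    using assms by (cases v; cases l; cases m; cases n) (auto simp: reduced_word_def)
qed

lemma reduced_append_reduced_cons:
  assumes "reduced_word w"
  shows "reduced_append (reduced_cons l u) w = reduced_cons l (reduced_append u w)"
  using assms
  by (cases u) (auto simp: reduced_cons_cancel reduced_word_reduced_append)

text \<open>Van der Waerden's trick: since words act on reduced words, associativity becomes
  composition of actions and follows by induction on \<open>u\<close>.\<close>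

lemma reduced_append_assoc:
  assumes "reduced_word w"
  shows "reduced_append (reduced_append u v) w = reduced_append u (reduced_append v w)"
  using assms by (induction u) (auto simp: reduced_append_reduced_cons)

lemma reduced_append_Nil: "reduced_word w \<Longrightarrow> reduced_append w [] = w"
proof (induction w)
  case (Cons l w)
  then show ?case
    by (cases w) (auto simp: reduced_word_def)
qed simp

lemma reduced_append_append:
  "reduced_append (u @ v) w = reduced_append u (reduced_append v w)"
  by (simp add: reduced_append_def)

lemma reduced_append_inverse_word:
  "reduced_word w \<Longrightarrow> reduced_append (inverse_word u) (reduced_append u w) = w"
  by (induction u)
    (auto simp: reduced_append_append reduced_cons_cancel reduced_word_reduced_append)

text \<open>Normalizing \<open>inverse_word u\<close> yields a reduced word, hence a left inverse
  lying in the carrier of the group below.\<close>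

lemma reduced_append_inverse_word_Nil:
  assumes "reduced_word u"
  shows "reduced_append (reduced_append (inverse_word u) []) u = []"
proof -
  have "reduced_append (reduced_append (inverse_word u) []) u = reduced_append (inverse_word u) u"
    using reduced_append_assoc[OF assms] by simp
  also have "\<dots> = reduced_append (inverse_word u) (reduced_append u [])"
    using assms by (simp add: reduced_append_Nil)
  also have "\<dots> = []" by (simp add: reduced_append_inverse_word reduced_word_def)
  finally show ?thesis .
qed

text \<open>The two generators are labelled by the Booleans. Words are coded by
  \<open>to_nat\<close> because the theorem asks for a group on the natural numbers.\<close>

definition free_group2 :: "nat monoid" where
  "free_group2 =
     \<lparr>carrier = to_nat ` {w :: (bool \<times> bool) list. reduced_word w},
      mult = (\<lambda>m n. to_nat (reduced_append (from_nat m :: (bool \<times> bool) list) (from_nat n))),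
      one = to_nat ([] :: (bool \<times> bool) list)\<rparr>"

definition free_group2_gen :: "bool \<Rightarrow> nat" where
  "free_group2_gen a = to_nat [(a, True)]"

lemma inj_free_group2_gen: "inj free_group2_gen"
  by (auto simp: inj_def free_group2_gen_def)

lemma reduced_word_single [simp]: "reduced_word []" "reduced_word [l]"
  by (simp_all add: reduced_word_def)

lemma group_free_group2: "group free_group2"
proof (rule groupI)
  fix g assume "g \<in> carrier free_group2"
  then obtain u :: "(bool \<times> bool) list" where u: "reduced_word u" "g = to_nat u"
    by (auto simp: free_group2_def)
  then show "\<exists>h\<in>carrier free_group2. h \<otimes>\<^bsub>free_group2\<^esub> g = \<one>\<^bsub>free_group2\<^esub>"
    by (intro bexI[of _ "to_nat (reduced_append (inverse_word u) [])"])
      (auto simp: free_group2_def reduced_append_inverse_word_Nil reduced_word_reduced_append)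
qed (auto simp: free_group2_def reduced_append_assoc reduced_word_reduced_append)

lemma letter_val_free_group2:
  "letter_val free_group2 (free_group2_gen a, b) = to_nat [(a, b)]"
proof (cases b)
  case False
  have "inv\<^bsub>free_group2\<^esub> free_group2_gen a = to_nat [(a, False)]"
    by (rule group.inv_equality[OF group_free_group2])
      (auto simp: free_group2_def free_group2_gen_def)
  with False show ?thesis by (simp add: letter_val_def)
qed (simp add: letter_val_def free_group2_gen_def)

text \<open>Evaluation is reduction, so a reduced word evaluates to its own code. Generation and
  freeness both follow from this.\<close>

lemma word_val_free_group2:
  "word_val free_group2 (map (map_prod free_group2_gen id) w) = to_nat (reduced_append w [])"
proof (induction w)
  case (Cons l w)
  then show ?case
    by (cases l) (simp add: letter_val_free_group2, simp add: free_group2_def)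
qed (simp add: free_group2_def)

lemma words_over_range:
  fixes f :: "'a \<Rightarrow> 'b"
  shows "words_over (range f) = range (map (map_prod f id))"
proof (intro equalityI subsetI)
  fix w assume "w \<in> words_over (range f)"
  then show "w \<in> range (map (map_prod f id))"
  proof (induction w)
    case (Cons l w)
    then have "fst l \<in> range f" "w \<in> range (map (map_prod f id))"
      using Cons.IH by (simp_all only: words_over_simps)
    then obtain a v where "fst l = f a" "w = map (map_prod f id) v" by blast
    then have "l # w = map (map_prod f id) ((a, snd l) # v)" by (simp add: prod_eq_iff)
    then show ?case by (rule range_eqI)
  qed auto
next
  fix w :: "('b \<times> bool) list" assume "w \<in> range (map (map_prod f id))"
  then obtain v where v: "w = map (map_prod f id) v" by auto
  show "w \<in> words_over (range f)" unfolding v by (induction v) auto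
qed

lemma reduced_word_map_prod:
  assumes "inj f"
  shows "reduced_word (map (map_prod f id) w) \<longleftrightarrow> reduced_word w"
  unfolding reduced_word_def successively_map
  by (intro successively_cong) (auto dest: injD[OF assms])

lemma free_generating_set_free_group2:
  "free_generating_set free_group2 (range free_group2_gen)"
proof -
  interpret group free_group2 by (rule group_free_group2)
  have sub: "range free_group2_gen \<subseteq> carrier free_group2"
    by (auto simp: free_group2_def free_group2_gen_def)
  have "carrier free_group2 \<subseteq> generate free_group2 (range free_group2_gen)"
  proof
    fix g assume "g \<in> carrier free_group2"
    then obtain w :: "(bool \<times> bool) list" where "reduced_word w" "g = to_nat w"
      by (auto simp: free_group2_def)
    then have "g = word_val free_group2 (map (map_prod free_group2_gen id) w)"
      by (simp add: word_val_free_group2 reduced_append_Nil)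
    then show "g \<in> generate free_group2 (range free_group2_gen)"
      unfolding generate_eq_word_val[OF sub] words_over_range by blast
  qed
  moreover have "word_val free_group2 w \<noteq> \<one>\<^bsub>free_group2\<^esub>"
    if w: "w \<in> words_over (range free_group2_gen)" "reduced_word w" "w \<noteq> []" for w
  proof -
    obtain v where v: "w = map (map_prod free_group2_gen id) v"
      using w(1) unfolding words_over_range by blast
    with w have "reduced_word v" "v \<noteq> []"
      using reduced_word_map_prod[OF inj_free_group2_gen] by auto
    then show ?thesis
      by (simp add: v word_val_free_group2 reduced_append_Nil)
        (simp add: free_group2_def)
  qed
  ultimately show ?thesis
    using generate_in_carrier[OF sub] sub unfolding free_generating_set_def by blast
qed

text \<open>The powers of one generator are reduced words of different lengths.\<close>

lemma infinite_carrier_free_group2: "infinite (carrier free_group2)"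
proof
  assume "finite (carrier free_group2)"
  moreover have "reduced_word (replicate n (True, True))" for n
    by (auto simp: reduced_word_def successively_conv_nth)
  then have "(\<lambda>n. to_nat (replicate n (True, True))) ` UNIV \<subseteq> carrier free_group2"
    by (auto simp: free_group2_def)
  ultimately have "finite (range (\<lambda>n. to_nat (replicate n (True, True))))"
    by (rule finite_subset[rotated])
  moreover have "inj (\<lambda>n. to_nat (replicate n (True, True)))"
    by (auto simp: inj_def dest: arg_cong[where f = length])
  ultimately show False by (auto dest: finite_imageD)
qed

lemma (in group) infinite_rcosets_trivial:
  assumes "infinite (carrier G)"
  shows "infinite (rcosets {\<one>})"
proof -
  have "rcosets {\<one>} = (\<lambda>g. {g}) ` carrier G"
    by (auto simp: RCOSETS_def r_coset_def)
  with assms show ?thesis by (auto dest: finite_imageD)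
qed

subsection \<open>Trivial actions\<close>

text \<open>The identity is restricted to \<open>X\<close> because a \<open>group_action\<close>
  takes values in \<open>Bij\<close>, whose members are extensional.\<close>

definition trivial_action :: "'x set \<Rightarrow> 'g \<Rightarrow> 'x \<Rightarrow> 'x" where
  "trivial_action X g = (\<lambda>x\<in>X. x)"

lemma (in group) pmp_action_trivial_action: "pmp_action G M (trivial_action (space M))"
proof -
  have "group_action G (space M) (trivial_action (space M))"
    unfolding group_action_def group_hom_def group_hom_axioms_def
    using group_BijGroup is_group id_Bij[of "space M"]
    by (auto simp: hom_def BijGroup_def trivial_action_def compose_def restrict_def fun_eq_iff)
  moreover have "trivial_action (space M) g \<in> measurable M M" for g :: 'a
    by (subst measurable_cong[where g = "\<lambda>x. x"]) (auto simp: trivial_action_def)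
  moreover have "distr M M (trivial_action (space M) g) = M" for g :: 'a
  proof -
    have "distr M M (trivial_action (space M) g) = distr M M (\<lambda>x. x)"
      by (rule distr_cong) (auto simp: trivial_action_def)
    then show ?thesis by simp
  qed
  ultimately show ?thesis by (simp add: pmp_action_def)
qed

text \<open>Under the trivial action all translates of \<alpha> coincide, so every join taken below
  is over the one-element family of \<alpha>. As \<open>common_refinement\<close> discards the empty
  set, \<alpha> must not contain it.\<close>

lemma common_refinement_single:
  assumes "{} \<notin> \<alpha>"
  shows "common_refinement {\<alpha>} = \<alpha>"
proof -
  have "(\<Union>f \<in> (\<Pi> P\<in>{\<alpha>}. P). {\<Inter> (f ` {\<alpha>})}) = \<alpha>"
    by (auto intro!: bexI[of _ "\<lambda>_. _"])
  with assms show ?thesis by (simp add: common_refinement)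
qed

lemma translate_trivial_action:
  assumes "partition_on X \<alpha>"
  shows "translate (trivial_action X) g \<alpha> = \<alpha>"
proof -
  have "trivial_action X g ` A = A" if "A \<in> \<alpha>" for A
    using assms that by (force simp: trivial_action_def partition_on_def)
  then show ?thesis by (simp add: translate_def)
qed

lemma translate_join_trivial_action:
  assumes "partition_on X \<alpha>" "F \<noteq> {}"
  shows "translate_join (trivial_action X) F \<alpha> = \<alpha>"
  \<comment> \<open>Since \<open>F\<close> is nonempty, the constant image of \<open>F\<close> is
    the family consisting of \<alpha> alone, not the empty family.\<close>
  using assms(2) partition_onD3[OF assms(1)]
  by (simp add: translate_join_def translate_trivial_action[OF assms(1)]
      common_refinement_single image_constant_conv)

lemma F_entropy_trivial_action:
  assumes "partition_on X \<alpha>"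
  shows "F_entropy M (trivial_action X) S \<alpha> =
    (1 - real (card S)) * enn2real (shannon_entropy M \<alpha>)"
  using partition_onD3[OF assms]
  by (simp add: F_entropy_def translate_trivial_action[OF assms] common_refinement_single
      algebra_simps)

lemma word_ball_nonempty: "word_ball G S n \<noteq> {}"
proof -
  have "word_val G [] \<in> word_ball G S n" 
    unfolding word_ball_def by (intro CollectI exI[of _ "[]"]) simp
  then show ?thesis by blast
qed

section \<open>The fair coin and its f-invariant\<close>

abbreviation coin :: "real measure" where
  "coin \<equiv> uniform_count_measure {0, 1}"

abbreviation coin_points :: "real set set" where
  "coin_points \<equiv> {{0}, {1}}"

text \<open>The discrete topology on two points is Polish, and its Borel sets are all
  subsets.\<close>

lemma standard_probability_space_coin: "standard_probability_space coin"
proof -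
  let ?T = "discrete_topology {0, 1::real}"
  have "sigma_sets {0, 1::real} (Pow {0, 1}) = Pow {0, 1}"
    by (rule sigma_algebra.sigma_sets_eq[OF sigma_algebra_Pow])
  then have "sets coin = sigma_sets (topspace ?T) {U. openin ?T U}"
    by (simp add: sets_uniform_count_measure Pow_def)
  moreover have "topspace ?T = space coin" by (simp add: space_uniform_count_measure)
  moreover have "prob_space coin"
    by (rule prob_space_uniform_count_measure) auto
  moreover have "completely_metrizable_space ?T" "second_countable ?T"
    by (simp_all add: completely_metrizable_space_discrete_topology
        second_countable_discrete_topology countable_finite)
  ultimately show ?thesis unfolding standard_probability_space_def by blast
qed

lemma shannon_entropy_coin_points: "shannon_entropy coin coin_points = ennreal (ln 2)"
proof -
  have "shannon_entropy coin coin_points =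
      (\<Sum>A\<in>coin_points. ennreal (- (measure coin A * ln (measure coin A))))"
    unfolding shannon_entropy_def by (rule infsum_finite) simp
  also have "\<dots> = ennreal (ln 2 / 2) + ennreal (ln 2 / 2)"
    by (simp add: measure_uniform_count_measure ln_div)
  also have "\<dots> = ennreal (ln 2)"
    by (subst ennreal_plus[symmetric]) auto
  finally show ?thesis .
qed

text \<open>A two-point set has only two partitions, and the one-class partition generates just the
  trivial \<sigma>-algebra. With this lemma the quantifier over \<alpha> in
  \<open>f_invariant_is\<close> collapses to a single case.\<close>

lemma generating_partition_coin_iff:
  "generating_partition G coin (trivial_action (space coin)) \<alpha> \<longleftrightarrow> \<alpha> = coin_points"
proof
  assume gen: "generating_partition G coin (trivial_action (space coin)) \<alpha>"
  then have part: "partition_on {0, 1} \<alpha>"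
    by (simp add: generating_partition_def countable_measurable_partition_def
        space_uniform_count_measure)
  have "{0, 1} \<notin> \<alpha>"
  proof
    assume "{0, 1} \<in> \<alpha>"
    have "A = {0, 1}" if "A \<in> \<alpha>" for A
    proof (rule ccontr)
      assume "A \<noteq> {0, 1}"
      then have "A \<inter> {0, 1} = {}"
        using disjointD[OF partition_onD2[OF part] that \<open>{0, 1} \<in> \<alpha>\<close>] by simp
      moreover have "A \<subseteq> {0, 1}" "A \<noteq> {}"
        using partition_onD1[OF part] partition_onD3[OF part] that by auto
      ultimately show False by blast
    qed
    with \<open>{0, 1} \<in> \<alpha>\<close> have "\<alpha> = {{0, 1}}" by blast
    then have "invariant_sigma_algebra G (space coin) (trivial_action (space coin))
        {{}, {0, 1}} \<and> \<alpha> \<subseteq> {{}, {0, 1}}"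
      by (simp add: invariant_sigma_algebra_def space_uniform_count_measure
          sigma_algebra_trivial trivial_action_def)
    moreover have "{0} \<in> sets coin" by (simp add: sets_uniform_count_measure)
    ultimately obtain C where C: "C \<in> {{}, {0, 1}}" "({0} - C) \<union> (C - {0}) \<in> null_sets coin"
      using gen unfolding generating_partition_def by blast
    \<comment> \<open>Both points have positive mass, so agreement up to null sets is equality;
      \<open>C\<close> would have to be the set of the point 0 alone.\<close>
    have null: "A \<in> null_sets coin \<Longrightarrow> A = {}" for A
      by (auto simp: null_sets_def sets_uniform_count_measure emeasure_uniform_count_measure
          ennreal_eq_0_iff finite_subset[of A "{0, 1}"])
    have "C = {0}" using null[OF C(2)] by blast
    then have "0 \<in> C" "1 \<notin> C" by simp_all
    moreover have "0 \<in> C \<longleftrightarrow> 1 \<in> C" using C(1) by blast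
    ultimately show False by blast
  qed
  moreover have "A \<in> {{0}, {1}, {0, 1}}" if "A \<in> \<alpha>" for A
  proof -
    have "A \<in> Pow {0, 1} - {{}}" using part that by (auto simp: partition_on_def)
    then show ?thesis by (auto simp: Pow_insert)
  qed
  ultimately have sub: "\<alpha> \<subseteq> coin_points" by blast
  have "0 \<in> \<Union>\<alpha>" "1 \<in> \<Union>\<alpha>" using partition_onD1[OF part] by blast+
  then obtain A B where "A \<in> \<alpha>" "0 \<in> A" "B \<in> \<alpha>" "1 \<in> B" by blast
  moreover have "A = {0}" "B = {1}" using calculation sub by auto
  ultimately show "\<alpha> = coin_points" using sub by blast
next
  assume \<alpha>: "\<alpha> = coin_points"
  have part: "countable_measurable_partition coin coin_points"
    by (auto simp: countable_measurable_partition_def sets_uniform_count_measure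
        space_uniform_count_measure partition_on_def disjoint_def)
  \<comment> \<open>Any \<sigma>-algebra containing both singletons is the full power set, so
    \<open>B\<close> approximates itself exactly.\<close>
  have gen: "B \<in> \<Sigma>" if B: "B \<in> sets coin"
    and inv: "invariant_sigma_algebra G (space coin) (trivial_action (space coin)) \<Sigma>"
    and sub: "coin_points \<subseteq> \<Sigma>" for B \<Sigma>
  proof -
    interpret sigma_algebra "{0, 1}" \<Sigma>
      using inv by (simp add: invariant_sigma_algebra_def space_uniform_count_measure)
    have "B \<in> Pow {0, 1}" using B by (simp add: sets_uniform_count_measure)
    then have "B = {} \<or> B = {0} \<or> B = {1} \<or> B = {0, 1}" by (auto simp: Pow_insert)
    then show ?thesis using sub top by auto
  qed
  show "generating_partition G coin (trivial_action (space coin)) \<alpha>"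
    unfolding generating_partition_def \<alpha>
  proof (intro conjI part ballI)
    fix B assume "B \<in> sets coin"
    then show "\<exists>C\<in>\<Inter> {\<Sigma>. invariant_sigma_algebra G (space coin) (trivial_action (space coin)) \<Sigma> \<and>
        coin_points \<subseteq> \<Sigma>}. (B - C) \<union> (C - B) \<in> null_sets coin"
      by (intro bexI[of _ B] InterI) (auto intro: gen)
  qed
qed

text \<open>The sequence defining the limit is constant, and by invariance of the rank its value is
  the same for every finite free generating set.\<close>

lemma f_invariant_coin:
  assumes "group G" "free_generating_set G S" "finite S"
  shows "f_invariant G coin (trivial_action (space coin)) = Some (ereal ((1 - real (card S)) * ln 2))"
proof -
  let ?v = "(1 - real (card S)) * ln 2"
  let ?\<phi> = "trivial_action (space coin)"
  have gen: "generating_partition G coin ?\<phi> coin_points"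
    by (simp add: generating_partition_coin_iff)
  then have part: "partition_on (space coin) coin_points"
    by (simp add: generating_partition_def countable_measurable_partition_def)
  have F: "F_entropy coin ?\<phi> T (translate_join ?\<phi> (word_ball G T n) coin_points) = ?v"
    if "finite T" "free_generating_set G T" for T n
    using group.free_generating_set_card_eq[OF assms that(2,1)]
    by (simp add: translate_join_trivial_action[OF part word_ball_nonempty]
        F_entropy_trivial_action[OF part] shannon_entropy_coin_points)
  have is_iff: "f_invariant_is G coin ?\<phi> v \<longleftrightarrow> v = ereal ?v" for v
  proof
    assume "f_invariant_is G coin ?\<phi> v"
    \<comment> \<open>Instantiating with the given \<open>S\<close> and \<open>coin_points\<close>
      forces the value of \<open>v\<close>, which gives the uniqueness needed for the definite
      description.\<close>
    then have "(\<lambda>n. ereal (F_entropy coin ?\<phi> S (translate_join ?\<phi> (word_ball G S n) coin_points)))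
        \<longlonglongrightarrow> v"
      unfolding f_invariant_is_def using assms gen by (simp add: shannon_entropy_coin_points)
    then show "v = ereal ?v"
      unfolding F[OF assms(3,2)] by (simp only: LIMSEQ_const_iff)
  next
    assume "v = ereal ?v"
    then show "f_invariant_is G coin ?\<phi> v"
      unfolding f_invariant_is_def generating_partition_coin_iff
      by (auto simp only: F intro: tendsto_const)
  qed
  have "(THE v. f_invariant_is G coin ?\<phi> v) = ereal ?v" by (rule the_equality) (simp_all add: is_iff)
  moreover have "fg_free_group G" using assms by (auto simp: fg_free_group_def)
  moreover have "\<exists>\<alpha>. generating_partition G coin ?\<phi> \<alpha> \<and> shannon_entropy coin \<alpha> < \<infinity>"
    using gen by (auto simp: shannon_entropy_coin_points intro!: exI[of _ coin_points])
  ultimately show ?thesis unfolding f_invariant_def by (simp only: if_True simp_thms)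
qed

theorem proposition5p9:
  shows "\<exists>(G :: nat monoid) (H :: nat set) (M :: real measure) (\<phi> :: nat \<Rightarrow> real \<Rightarrow> real).
    fg_free_group G \<and>
    subgroup H G \<and> infinite (rcosets\<^bsub>G\<^esub> H) \<and>
    standard_probability_space M \<and> pmp_action G M \<phi> \<and>
    f_invariant G M \<phi> \<noteq> None \<and>
    f_invariant (G\<lparr>carrier := H\<rparr>) M \<phi> \<noteq> None \<and>
    \<not> infinite_index_formula (f_invariant (G\<lparr>carrier := H\<rparr>) M \<phi>) (f_invariant G M \<phi>)"
proof -
  interpret group free_group2 by (rule group_free_group2)
  let ?H = "{\<one>\<^bsub>free_group2\<^esub>}"
  let ?\<phi> = "trivial_action (space coin)"
  have H: "subgroup ?H free_group2" by (rule triv_subgroup)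
  have "card (range free_group2_gen) = 2"
    using card_image[OF inj_free_group2_gen] by simp
  then have fG: "f_invariant free_group2 coin ?\<phi> = Some (ereal (- ln 2))"
    using f_invariant_coin[OF group_free_group2 free_generating_set_free_group2] by simp
  \<comment> \<open>The free generating set is \<open>{}\<close>, so the factor
    \<open>1 - real (card S)\<close> equals 1.\<close>
  have fH: "f_invariant (free_group2\<lparr>carrier := ?H\<rparr>) coin ?\<phi> = Some (ereal (ln 2))"
    using f_invariant_coin[OF subgroup.subgroup_is_group[OF H group_free_group2]
        free_generating_set_trivial] by simp
  have "fg_free_group free_group2"
    unfolding fg_free_group_def
    using group_free_group2 free_generating_set_free_group2 by (meson finite_imageI finite)
  moreover have "infinite (rcosets\<^bsub>free_group2\<^esub> ?H)"
    by (rule infinite_rcosets_trivial[OF infinite_carrier_free_group2])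
  \<comment> \<open>Two clauses fail: a finite value for the subgroup would require the value 0 for
    the group, and a negative value for the group would require minus infinity for the
    subgroup.\<close>
  moreover have "\<not> infinite_index_formula (Some (ereal (ln 2))) (Some (ereal (- ln 2)))"
    by (simp add: infinite_index_formula_def)
  ultimately show ?thesis
    by (intro exI[of _ free_group2] exI[of _ ?H] exI[of _ coin] exI[of _ ?\<phi>] conjI H
        standard_probability_space_coin pmp_action_trivial_action)
      (simp_all only: fG fH option.distinct not_False_eq_True)
qed

end
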